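(* Let $f:\mathbb{R}^n\to\mathbb{R}$ be a convex function with global minimum point $x^*$ which has an $L$-continuous gradient ($L>0$) and is $\mu$-strong convex ($\mu>0$). Let $\rho>0$ and $0<\beta<1$, and consider the algorithm $$\begin{cases}\dot x = -\theta\,\dfrac{\nabla f(x)}{\|\nabla f(x)\|^2},\\[2mm] \mathscr{D}^{\beta}\theta = \rho\|\nabla f(x)\|^2,\end{cases}$$ where $\theta(t)$ is scalar-valued with $\theta(0)=0$ and $\mathscr{D}^\beta$ is the Caputo derivative of order $\beta$. Then for every initial condition $x(0)\in\mathbb{R}^n$ the trajectory $x(t)$ reaches the minimum point $x^*$ in a finite time. Moreover, the convergence time is shorter than the first positive zero (in $t$) of the Mittag-Leffler function $$E_{\beta+1,1}\!\left(-\frac{2\rho\mu^2}{L}\,t^{1+\beta}\right).$$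
   Context: $\|\cdot\|$ is the Euclidean norm and $\langle\cdot,\cdot\rangle$ the inner product on $\mathbb{R}^n$; $\dot x$ denotes the derivative with respect to time $t$. A function $f$ whose gradient exists is said to have an $L$-continuous gradient ($L>0$) if $\langle \nabla f(\theta_1)-\nabla f(\theta_2),\theta_1-\theta_2\rangle\le L\|\theta_1-\theta_2\|^2$ for all $\theta_1,\theta_2$ in the domain of $f$. A convex function $f$ whose gradient exists is said to be $\mu$-strong convex ($\mu>0$) if $\langle \nabla f(\theta_1)-\nabla f(\theta_2),\theta_1-\theta_2\rangle\ge \mu\|\theta_1-\theta_2\|^2$ for all $\theta_1,\theta_2$ in the domain of $f$. For $0<\beta<1$ the Caputo derivative is $\mathscr{D}^\beta g(t)=\frac{1}{\Gamma(1-\beta)}\int_0^t \frac{g'(\tau)}{(t-\tau)^{\beta}}\,d\tau$. The Mittag-Leffler function is $E_{a,b}(z)=\sum_{k=0}^\infty \frac{z^k}{\Gamma(ak+b)}$ for $a>0$, $b>0$. The right-hand side of the $x$-dynamics is undefined where $\nabla f(x)=0$; the trajectory is understood to be continuous and to satisfy the equations until it reaches the minimum point. The convergence time is the time at which $x(t)$ reaches $x^*$.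
   Formalization: When μ = L and x(0) ≠ x*, the convergence time equals the first positive zero (e.g. f = (μ/2)‖x‖²), so "shorter than" is false there; the formal theorem proves "at most" in general and "strictly shorter" whenever μ < L or x(0) = x*. *)

theory Defs
  imports "HOL-Analysis.Analysis"
begin

definition gradient :: "('a::real_inner \<Rightarrow> real) \<Rightarrow> 'a \<Rightarrow> 'a" where
  "gradient f x = (THE D. GDERIV f x :> D)"

lemma gradient_eqI:
  fixes f :: "'a::real_inner \<Rightarrow> real"
  assumes "GDERIV f x :> D"
  shows "gradient f x = D"
  unfolding gradient_def
proof (rule the_equality)
  fix D' assume "GDERIV f x :> D'"
  with assms have "(\<lambda>h. inner h D') = (\<lambda>h. inner h D)"
    unfolding gderiv_def by (rule has_derivative_unique[rotated])
  then have "inner (D' - D) (D' - D) = 0"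
    by (metis inner_diff_right diff_self)
  then show "D' = D" by simp
qed (fact assms)

definition has_gradient_everywhere :: "('a::real_inner \<Rightarrow> real) \<Rightarrow> bool" where
  "has_gradient_everywhere f \<longleftrightarrow> (\<forall>y. \<exists>D. GDERIV f y :> D)"

(* The one-sided bound below is the intended condition; for convex f it implies
   that the gradient is Lipschitz with constant L. *)
definition L_continuous_gradient :: "real \<Rightarrow> ('a::real_inner \<Rightarrow> real) \<Rightarrow> bool" where
  "L_continuous_gradient L f \<longleftrightarrow> has_gradient_everywhere f \<and>
     (\<forall>y z. inner (gradient f y - gradient f z) (y - z) \<le> L * (norm (y - z))\<^sup>2)"

definition strong_convex :: "real \<Rightarrow> ('a::real_inner \<Rightarrow> real) \<Rightarrow> bool" where
  "strong_convex \<mu> f \<longleftrightarrow> convex_on UNIV f \<and> has_gradient_everywhere f \<and>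
     (\<forall>y z. inner (gradient f y - gradient f z) (y - z) \<ge> \<mu> * (norm (y - z))\<^sup>2)"

definition mittag_leffler :: "real \<Rightarrow> real \<Rightarrow> real \<Rightarrow> real" where
  "mittag_leffler a b z = (\<Sum>k. z ^ k / Gamma (a * real k + b))"

definition caputo :: "real \<Rightarrow> (real \<Rightarrow> real) \<Rightarrow> real \<Rightarrow> real" where
  "caputo \<beta> g t = 1 / Gamma (1 - \<beta>) * integral {0..t} (\<lambda>\<tau>. deriv g \<tau> / (t - \<tau>) powr \<beta>)"

(* The Caputo derivative at t is meaningful: g' exists on the open interval (it may blow up
   at 0, as it does for t powr \<beta>) and the integral is a Lebesgue integral.  Continuity
   on the closed interval ties the value g 0 to g'. *)
definition caputo_differentiable :: "real \<Rightarrow> (real \<Rightarrow> real) \<Rightarrow> real \<Rightarrow> bool" where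
  "caputo_differentiable \<beta> g t \<longleftrightarrow>
     continuous_on {0..t} g \<and> (\<forall>\<tau>\<in>{0<..<t}. g differentiable (at \<tau>)) \<and>
     (\<lambda>\<tau>. deriv g \<tau> / (t - \<tau>) powr \<beta>) absolutely_integrable_on {0..t}"

(* x is continuous on [0,\<infinity>); the equations are imposed only while the minimum point
   p has not been reached, and nothing but continuity of x afterwards.  They are imposed for
   t > 0 only, because the Caputo integral over the degenerate interval {0..0} is 0. *)
definition trajectory ::
  "('a::real_inner \<Rightarrow> real) \<Rightarrow> 'a \<Rightarrow> real \<Rightarrow> real \<Rightarrow> (real \<Rightarrow> 'a) \<Rightarrow> (real \<Rightarrow> real) \<Rightarrow> bool" where
  "trajectory f p \<rho> \<beta> x \<theta> \<longleftrightarrow>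
     continuous_on {0..} x \<and> \<theta> 0 = 0 \<and>
     (\<forall>t>0. (\<forall>s\<in>{0..t}. x s \<noteq> p) \<longrightarrow>
        (x has_vector_derivative
           - (\<theta> t *\<^sub>R (gradient f (x t) /\<^sub>R (norm (gradient f (x t)))\<^sup>2))) (at t) \<and>
        caputo_differentiable \<beta> \<theta> t \<and>
        caputo \<beta> \<theta> t = \<rho> * (norm (gradient f (x t)))\<^sup>2)"

definition is_convergence_time :: "(real \<Rightarrow> 'a) \<Rightarrow> 'a \<Rightarrow> real \<Rightarrow> bool" where
  "is_convergence_time x p T \<longleftrightarrow> 0 \<le> T \<and> x T = p \<and> (\<forall>s\<in>{0..<T}. x s \<noteq> p)"

definition is_first_positive_zero :: "(real \<Rightarrow> real) \<Rightarrow> real \<Rightarrow> bool" where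
  "is_first_positive_zero F z \<longleftrightarrow> 0 < z \<and> F z = 0 \<and> (\<forall>s\<in>{0<..<z}. F s \<noteq> 0)"

end

theory Submission
  imports Defs
begin

text \<open>
  The gap \<open>V(t) = f(x(t)) - f(x\<^sup>*)\<close> turns the system into a scalar one. By the chain rule
  \<open>V' = -\<theta>\<close>: the factor \<open>1/\<parallel>\<nabla>f\<parallel>\<^sup>2\<close> in the dynamics is there to make this so. Strong convexity gives
  the Polyak-Lojasiewicz inequality \<open>\<parallel>\<nabla>f(x)\<parallel>\<^sup>2 \<ge> 2\<mu>V\<close>, hence \<open>D\<^sup>\<beta>\<theta> \<ge> cV\<close> with \<open>c = 2\<rho>\<mu>\<close>.
  If this were an equality, \<open>V\<close> would be \<open>V(0)u\<close> with \<open>u(t) = E(-c t\<^sup>a)\<close>, where \<open>a = \<beta> + 1\<close> and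
  \<open>E\<close> is the Mittag-Leffler function with parameters \<open>a\<close> and \<open>1\<close>. The heart of the proof is the
  comparison \<open>V \<le> V(0)u\<close>, valid as long as \<open>u \<ge> 0\<close> (\<open>caputo_comparison\<close>): at the first zero of \<open>u\<close>
  it contradicts \<open>V > 0\<close>, so the trajectory has met the minimum point by then.

  The comparison holds for the following reason. Let \<open>q\<close> be the fractional integral of order \<open>\<beta>\<close> of
  \<open>u\<close>. Then \<open>u' = -cq\<close>, and \<open>q \<ge> 0\<close> on \<open>[0,T]\<close> if \<open>u \<ge> 0\<close> there. Therefore
  \<open>D\<^sup>\<beta>\<theta> \<ge> cV\<close> may be multiplied by \<open>q(T - s)\<close> and integrated over \<open>[0,T]\<close>. The operator \<open>D\<^sup>\<beta>\<close>
  convolves \<open>\<theta>'\<close> with the Riemann-Liouville kernel of order \<open>1 - \<beta>\<close>, and convolving \<open>q\<close> with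
  that kernel gives the primitive \<open>e\<close> of \<open>u\<close>, so that by Fubini
  \<open>\<integral> q(T - s) D\<^sup>\<beta>\<theta>(s) ds = \<integral> e(T - s) \<theta>'(s) ds\<close>. Now
  \<open>cq(T - s)V(s) - e(T - s)\<theta>'(s)\<close> is the derivative of \<open>u(T - s)V(s) - e(T - s)\<theta>(s)\<close>, whose
  increment over \<open>[0,T]\<close> is \<open>V(T) - u(T)V(0)\<close>; thus this increment is at most \<open>0\<close>.

  The functions \<open>u\<close>, \<open>q\<close> and \<open>e\<close> belong to one family,
  \<open>t\<^sup>b\<^sup>-\<^sup>1\<close> times the Mittag-Leffler function with parameters \<open>a, b\<close> at \<open>-c t\<^sup>a\<close>, for \<open>b = 1\<close>, \<open>b = a\<close>
  and \<open>b = 2\<close>; fractional integration of order \<open>g\<close> raises \<open>b\<close> by \<open>g\<close> (\<open>ml_kernel_convolution\<close>).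
  The same family yields the existence of a zero: \<open>u\<close> is \<open>1\<close> minus \<open>c\<close> times its own fractional
  integral of order \<open>a > 1\<close>, and this integral would grow beyond every bound if \<open>u\<close> stayed positive.

  The rate \<open>2\<rho>\<mu>\<^sup>2/L\<close> of the theorem equals \<open>(\<mu>/L) c\<close>. Rescaling time multiplies the first zero by
  \<open>(\<mu>/L)\<close> to the power \<open>1/a\<close> on passing from this rate to \<open>c\<close>; as \<open>\<mu> \<le> L\<close>, the zero for \<open>c\<close> comes
  no later, and strictly earlier if \<open>\<mu> < L\<close>.
\<close>

section \<open>Riemann-Liouville and Mittag-Leffler kernels\<close>

text \<open>
  Convolution with this kernel is fractional integration of order \<open>a\<close>. It vanishes for \<open>t \<le> 0\<close>
  (also for \<open>a = 1\<close>, because \<open>0 powr 0 = 0\<close>), so that convolutions over \<open>[0,t]\<close> can be written as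
  integrals over the whole line.
\<close>
definition rl_kernel :: "real \<Rightarrow> real \<Rightarrow> real" where
  "rl_kernel a t = max 0 t powr (a - 1) / Gamma a"

lemma rl_kernel_nonpos [simp]: "t \<le> 0 \<Longrightarrow> rl_kernel a t = 0"
  by (simp add: rl_kernel_def max_def)

lemma rl_kernel_nonneg: "a > 0 \<Longrightarrow> rl_kernel a t \<ge> 0"
  by (simp add: rl_kernel_def)

lemma rl_kernel_measurable [measurable]: "rl_kernel a \<in> borel_measurable borel"
  unfolding rl_kernel_def by measurable

lemma rl_kernel_scale:
  assumes "t > 0"
  shows "rl_kernel a (t * s) = t powr (a - 1) * rl_kernel a s"
proof -
  have "max 0 (t * s) = t * max 0 s"
    using assms by (auto simp: max_def zero_le_mult_iff mult_le_0_iff)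
  then show ?thesis
    using assms by (simp add: rl_kernel_def powr_mult)
qed

text \<open>
  The semigroup law of fractional integration; for \<open>t = 1\<close> it is Euler's Beta integral, and the
  general case follows by homogeneity.
\<close>
lemma rl_kernel_convolution:
  assumes a: "a > 0" and b: "b > 0"
  shows "has_bochner_integral lborel (\<lambda>s. rl_kernel a (t - s) * rl_kernel b s) (rl_kernel (a + b) t)"
proof (cases "t > 0")
  case False
  then have "(\<lambda>s. rl_kernel a (t - s) * rl_kernel b s) = (\<lambda>s. 0)"
    by (intro ext) (metis diff_le_0_iff_le linorder_le_cases linorder_not_less mult_eq_0_iff order_trans rl_kernel_nonpos)
  then show ?thesis using False by (simp add: has_bochner_integral_zero)
next
  case True
  let ?f = "\<lambda>s. rl_kernel a (1 - s) * rl_kernel b s"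
  have G: "Gamma a > 0" "Gamma b > 0" "Gamma (a + b) > 0"
    using a b by auto
  have "((\<lambda>s. s powr (b - 1) * (1 - s) powr (a - 1) / (Gamma a * Gamma b)) has_integral
          Beta b a / (Gamma a * Gamma b)) {0..1}"
    by (intro has_integral_divide has_integral_Beta_real a b)
  also have "Beta b a / (Gamma a * Gamma b) = 1 / Gamma (a + b)"
    using G by (simp add: Beta_def add.commute)
  finally have "(?f has_integral 1 / Gamma (a + b)) {0..1}"
    by (rule has_integral_eq[rotated]) (auto simp: rl_kernel_def)
  then have "(?f has_integral 1 / Gamma (a + b)) UNIV"
    by (rule has_integral_on_superset) (auto simp: not_le)
  then have "integral\<^sup>N lborel ?f = ennreal (1 / Gamma (a + b))"
    by (intro nn_integral_has_integral_lborel) (auto intro!: mult_nonneg_nonneg rl_kernel_nonneg a b)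
  then have "has_bochner_integral lborel ?f (1 / Gamma (a + b))"
    using G by (intro has_bochner_integral_nn_integral)
      (auto intro!: mult_nonneg_nonneg rl_kernel_nonneg a b)
  then have "has_bochner_integral lborel (\<lambda>s. ?f (0 + (1 / t) * s)) ((1 / Gamma (a + b)) /\<^sub>R \<bar>1 / t\<bar>)"
    using True by (subst (asm) lborel_has_bochner_integral_real_affine_iff[of "1 / t" _ _ 0]) auto
  then have *: "has_bochner_integral lborel (\<lambda>s. t powr (a + b - 2) * ?f (s / t))
      (t powr (a + b - 2) * (t / Gamma (a + b)))"
    using True by (intro has_bochner_integral_mult_right) (simp add: field_simps)
  have "rl_kernel a (t - s) * rl_kernel b s = t powr (a + b - 2) * ?f (s / t)" for s
  proof -
    have "t * (1 - s / t) = t - s" "t * (s / t) = s"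
      using True by (simp_all add: field_simps)
    then have "rl_kernel a (t - s) * rl_kernel b s = (t powr (a - 1) * t powr (b - 1)) * ?f (s / t)"
      using rl_kernel_scale[OF True, of a "1 - s / t"] rl_kernel_scale[OF True, of b "s / t"] by simp
    also have "t powr (a - 1) * t powr (b - 1) = t powr (a + b - 2)"
      by (simp add: powr_add[symmetric])
    finally show ?thesis .
  qed
  moreover have "t powr (a + b - 2) * (t / Gamma (a + b)) = rl_kernel (a + b) t"
  proof -
    have "t powr (a + b - 2) * t powr 1 = t powr (a + b - 1)"
      by (simp only: powr_add[symmetric]) simp
    then show ?thesis using True by (simp add: rl_kernel_def)
  qed
  ultimately show ?thesis using * by simp
qed

text \<open>
  Ratio test: \<open>Gamma (y + a) \<ge> Gamma (y + 1) = y * Gamma y\<close>, as \<open>Gamma\<close> increases beyond \<open>3/2\<close>.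
\<close>
lemma summable_mittag_leffler:
  fixes a b z :: real
  assumes a: "a \<ge> 1" and b: "b > 0"
  shows "summable (\<lambda>k. z ^ k / Gamma (a * real k + b))"
proof -
  obtain N :: nat where N: "real N \<ge> 2 * \<bar>z\<bar> + 2"
    using real_arch_simple by blast
  show ?thesis
  proof (rule summable_ratio_test[of "1/2" N])
    fix k :: nat assume "k \<ge> N"
    define y where "y = a * real k + b"
    have "real k \<le> a * real k" using a mult_right_mono[of 1 a "real k"] by simp
    then have y: "y \<ge> 2 * \<bar>z\<bar> + 2" unfolding y_def using N b \<open>k \<ge> N\<close> by linarith
    have G: "Gamma y > 0" "Gamma (y + a) > 0" using y a by auto
    have "2 * \<bar>z\<bar> * Gamma y \<le> y * Gamma y"
      using y G by (intro mult_right_mono) auto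
    also have "\<dots> = Gamma (y + 1)"
      using y by (intro Gamma_plus1[symmetric]) (auto elim!: nonpos_Ints_cases')
    also have "\<dots> \<le> Gamma (y + a)"
    proof (cases "a = 1")
      case False
      then show ?thesis using y a by (intro less_imp_le Gamma_real_strict_mono) linarith+
    qed simp
    finally have "\<bar>z\<bar> / Gamma (y + a) \<le> 1/2 * (1 / Gamma y)"
      using G by (simp add: field_simps)
    then have "\<bar>z\<bar> ^ k * (\<bar>z\<bar> / Gamma (y + a)) \<le> \<bar>z\<bar> ^ k * (1/2 * (1 / Gamma y))"
      by (intro mult_left_mono) auto
    moreover have "a * real (Suc k) + b = y + a" by (simp add: y_def algebra_simps)
    ultimately show "norm (z ^ Suc k / Gamma (a * real (Suc k) + b)) \<le> 1/2 * norm (z ^ k / Gamma (a * real k + b))"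
      using G by (simp add: y_def[symmetric] abs_mult power_abs mult_ac)
  qed simp
qed

text \<open>
  This is \<open>t\<^sup>b\<^sup>-\<^sup>1\<close> times the Mittag-Leffler function with parameters \<open>a, b\<close> at \<open>-c t\<^sup>a\<close> (see
  \<open>ml_kernel_eq\<close>). Writing it as a series of Riemann-Liouville kernels makes its behaviour under
  fractional integration visible term by term.
\<close>
definition ml_kernel :: "real \<Rightarrow> real \<Rightarrow> real \<Rightarrow> real \<Rightarrow> real" where
  "ml_kernel c a b t = (\<Sum>k. (- c) ^ k * rl_kernel (a * real k + b) t)"

lemma ml_kernel_term:
  assumes "t > 0"
  shows "(- c) ^ k * rl_kernel (a * real k + b) t =
    t powr (b - 1) * ((- (c * t powr a)) ^ k / Gamma (a * real k + b))"
proof -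
  have "t powr (a * real k + b - 1) = t powr (b - 1 + a * real k)"
    by (simp add: add_ac diff_add_eq)
  also have "\<dots> = t powr (b - 1) * (t powr a) powr (real k)"
    by (simp only: powr_add powr_powr)
  also have "(t powr a) powr (real k) = (t powr a) ^ k"
    using assms by (intro powr_realpow) simp
  finally have "t powr (a * real k + b - 1) = t powr (b - 1) * (t powr a) ^ k" .
  moreover have "(- (c * t powr a)) ^ k = (- c) ^ k * (t powr a) ^ k"
    by (simp add: power_mult_distrib[symmetric])
  ultimately show ?thesis using assms by (simp add: rl_kernel_def)
qed

lemma summable_ml_kernel:
  assumes "a \<ge> 1" "b > 0"
  shows "summable (\<lambda>k. (- c) ^ k * rl_kernel (a * real k + b) t)"
proof (cases "t > 0")
  case True
  then show ?thesis
    unfolding ml_kernel_term[OF True] by (intro summable_mult summable_mittag_leffler assms)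
qed simp

lemma ml_kernel_nonpos [simp]: "t \<le> 0 \<Longrightarrow> ml_kernel c a b t = 0"
  by (simp add: ml_kernel_def)

lemma ml_kernel_eq:
  assumes "a \<ge> 1" "b > 0"
  shows "ml_kernel c a b t = max 0 t powr (b - 1) * mittag_leffler a b (- (c * max 0 t powr a))"
proof (cases "t > 0")
  case True
  then show ?thesis
    unfolding ml_kernel_def mittag_leffler_def ml_kernel_term[OF True]
    by (subst suminf_mult) (use True in \<open>auto intro!: summable_mittag_leffler assms\<close>)
qed (simp add: max_def)

lemma isCont_mittag_leffler:
  assumes "a \<ge> 1" "b > 0"
  shows "isCont (mittag_leffler a b) z"
  using isCont_powser_converges_everywhere[of "\<lambda>k. 1 / Gamma (a * real k + b)" z]
    summable_mittag_leffler[OF assms]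
  by (simp add: mittag_leffler_def[abs_def])

lemma mittag_leffler_0: "b > 0 \<Longrightarrow> mittag_leffler a b 0 = 1 / Gamma b"
  unfolding mittag_leffler_def using powser_zero[of "\<lambda>k. 1 / Gamma (a * real k + b)"] by simp

lemma continuous_on_ml_kernel [continuous_intros]:
  assumes a: "a \<ge> 1" and b: "b > 1" and f: "continuous_on S f"
  shows "continuous_on S (\<lambda>t. ml_kernel c a b (f t))"
proof -
  have *: "continuous_on UNIV (mittag_leffler a b)"
    using a b by (intro continuous_at_imp_continuous_on ballI isCont_mittag_leffler) auto
  have "continuous_on S (\<lambda>t. mittag_leffler a b (- (c * max 0 (f t) powr a)))"
    by (rule continuous_on_compose2[OF *])
       (use a in \<open>auto intro!: continuous_intros continuous_on_powr' f\<close>)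
  then show ?thesis
    using a b by (subst ml_kernel_eq) (auto intro!: continuous_intros continuous_on_powr' f)
qed

lemma ml_kernel_measurable [measurable]: "ml_kernel c a b \<in> borel_measurable borel"
  unfolding ml_kernel_def by measurable

text \<open>
  Splitting off the first term of the series. Since \<open>ml_kernel c a (a + b)\<close> is the fractional integral
  of order \<open>a\<close> of \<open>ml_kernel c a b\<close>, this is the Volterra equation that characterises the kernel.
\<close>
lemma ml_kernel_shift:
  assumes "a \<ge> 1" "b > 0"
  shows "ml_kernel c a b t = rl_kernel b t - c * ml_kernel c a (a + b) t"
proof -
  have "ml_kernel c a b t = (\<Sum>k. (- c) ^ Suc k * rl_kernel (a * real (Suc k) + b) t) + rl_kernel b t"
    unfolding ml_kernel_def using suminf_split_head[OF summable_ml_kernel[OF assms, of c t]] by simp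
  also have "(\<Sum>k. (- c) ^ Suc k * rl_kernel (a * real (Suc k) + b) t) =
      (\<Sum>k. (- c) * ((- c) ^ k * rl_kernel (a * real k + (a + b)) t))"
    by (simp add: algebra_simps)
  also have "\<dots> = - c * ml_kernel c a (a + b) t"
    unfolding ml_kernel_def using assms by (intro suminf_mult summable_ml_kernel) auto
  finally show ?thesis by simp
qed

text \<open>
  Termwise the semigroup law. Sum and integral may be exchanged because the integrals of the absolute
  values are the terms of the kernel with \<open>- \<bar>c\<bar>\<close> in place of \<open>c\<close>, a convergent series.
\<close>
lemma ml_kernel_convolution:
  assumes a: "a \<ge> 1" and b: "b > 0" and g: "g > 0"
  shows "has_bochner_integral lborel (\<lambda>s. rl_kernel g (t - s) * ml_kernel c a b s) (ml_kernel c a (b + g) t)"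
proof -
  define f where "f k s = (- c) ^ k * (rl_kernel g (t - s) * rl_kernel (a * real k + b) s)" for k s
  have pos: "a * real k + b > 0" for k using a b by (simp add: add_nonneg_pos)
  have f: "has_bochner_integral lborel (f k) ((- c) ^ k * rl_kernel (a * real k + (b + g)) t)" for k
    unfolding f_def using has_bochner_integral_mult_right[OF rl_kernel_convolution[OF g pos[of k], of t], of "(- c) ^ k"]
    by (simp add: algebra_simps)
  have n: "norm (f k s) = \<bar>c\<bar> ^ k * (rl_kernel g (t - s) * rl_kernel (a * real k + b) s)" for k s
    using rl_kernel_nonneg[OF g] rl_kernel_nonneg[OF pos]
    by (simp add: f_def abs_mult power_abs)
  have nf: "(\<integral>s. norm (f k s) \<partial>lborel) = \<bar>c\<bar> ^ k * rl_kernel (a * real k + (b + g)) t" for k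
    unfolding n
    using has_bochner_integral_integral_eq[OF has_bochner_integral_mult_right[OF rl_kernel_convolution[OF g pos[of k], of t], of "\<bar>c\<bar> ^ k"]]
    by (simp add: algebra_simps)
  have int: "integrable lborel (f k)" for k
    using f by (auto simp: has_bochner_integral_iff)
  have ae: "AE s in lborel. summable (\<lambda>k. norm (f k s))"
  proof (rule AE_I2)
    fix s show "summable (\<lambda>k. norm (f k s))"
      unfolding n using summable_mult[OF summable_ml_kernel[OF a b, of "- \<bar>c\<bar>" s], of "rl_kernel g (t - s)"]
      by (simp add: mult_ac)
  qed
  have su: "summable (\<lambda>k. \<integral>s. norm (f k s) \<partial>lborel)"
    unfolding nf using summable_ml_kernel[OF a, of "b + g" "- \<bar>c\<bar>" t] b g by simp
  have eq: "(\<Sum>k. f k s) = rl_kernel g (t - s) * ml_kernel c a b s" for s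
    unfolding f_def ml_kernel_def
    by (subst suminf_mult[symmetric]) (auto intro!: summable_ml_kernel a b simp: mult_ac)
  show ?thesis
    using integrable_suminf[OF int ae su] integral_suminf[OF int ae su]
      has_bochner_integral_integral_eq[OF f]
    by (simp add: has_bochner_integral_iff eq ml_kernel_def)
qed

text \<open>
  Fractional integration of order \<open>1\<close> is integration, so the fundamental theorem applies to
  \<open>ml_kernel_convolution\<close> with \<open>g = 1\<close>. Continuity of the integrand at \<open>0\<close> requires \<open>b > 1\<close>.
\<close>
lemma ml_kernel_has_derivative:
  assumes a: "a \<ge> 1" and b: "b > 1" and t: "t > 0"
  shows "(ml_kernel c a (b + 1) has_real_derivative ml_kernel c a b t) (at t)"
proof -
  have cont: "continuous_on S (ml_kernel c a b)" for S
    using continuous_on_ml_kernel[OF a b continuous_on_id] by simp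
  have eq: "ml_kernel c a (b + 1) s = integral {0..s} (ml_kernel c a b)" if "s > 0" for s
  proof -
    have "has_bochner_integral lborel (\<lambda>r. rl_kernel 1 (s - r) * ml_kernel c a b r) (ml_kernel c a (b + 1) s)"
      using a b by (intro ml_kernel_convolution) auto
    then have "((\<lambda>r. rl_kernel 1 (s - r) * ml_kernel c a b r) has_integral ml_kernel c a (b + 1) s) UNIV"
      by (metis has_bochner_integral_iff has_integral_integral_lborel)
    also have "(\<lambda>r. rl_kernel 1 (s - r) * ml_kernel c a b r) =
        (\<lambda>r. if r \<in> {0..<s} then ml_kernel c a b r else 0)"
      by (auto simp: fun_eq_iff rl_kernel_def not_le max_def)
    finally have "(ml_kernel c a b has_integral ml_kernel c a (b + 1) s) {0..<s}"
      by (simp only: has_integral_restrict_UNIV)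
    then have "(ml_kernel c a b has_integral ml_kernel c a (b + 1) s) {0..s}"
    proof (rule has_integral_spike_set_eq[THEN iffD1, rotated 2])
      show "negligible {x \<in> {0..<s} - {0..s}. ml_kernel c a b x \<noteq> 0}"
        by (rule negligible_subset[of "{}"]) auto
      show "negligible {x \<in> {0..s} - {0..<s}. ml_kernel c a b x \<noteq> 0}"
        by (rule negligible_subset[of "{s}"]) auto
    qed
    then show ?thesis by (rule integral_unique[symmetric])
  qed
  have "((\<lambda>s. integral {0..s} (ml_kernel c a b)) has_real_derivative ml_kernel c a b t) (at t within {0..t+1})"
    using t by (intro integral_has_real_derivative cont) auto
  then have "((\<lambda>s. integral {0..s} (ml_kernel c a b)) has_real_derivative ml_kernel c a b t) (at t)"
    using t by (subst (asm) at_within_interior) auto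
  then show ?thesis
    by (rule has_field_derivative_transform_within_open[where S = "{0<..}"]) (use t eq in auto)
qed

section \<open>First zeros of Mittag-Leffler functions\<close>

lemma ml_kernel_1:
  assumes "a \<ge> 1" "t > 0"
  shows "ml_kernel c a 1 t = mittag_leffler a 1 (- c * t powr a)"
  using assms by (subst ml_kernel_eq) auto

text \<open>
  The right-hand side is continuous on the whole line and is differentiated by
  \<open>ml_kernel_has_derivative\<close>, whereas \<open>ml_kernel c a 1\<close> jumps at \<open>0\<close>.
\<close>
lemma mittag_leffler_conv_ml_kernel:
  assumes "a \<ge> 1" "t \<ge> 0"
  shows "mittag_leffler a 1 (- c * t powr a) = 1 - c * ml_kernel c a (a + 1) t"
proof (cases "t = 0")
  case True
  then show ?thesis using assms by (simp add: mittag_leffler_0)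
next
  case False
  then have "t > 0" using assms by simp
  moreover from this have "rl_kernel 1 t = 1" by (simp add: rl_kernel_def)
  ultimately show ?thesis
    using ml_kernel_shift[of a 1 c t] ml_kernel_1[of a t c] assms by simp
qed

lemma first_hitting_time_exists:
  fixes x :: "real \<Rightarrow> 'a::t1_space"
  assumes cont: "continuous_on {0..t} x" and hit: "s0 \<in> {0..t}" "x s0 = p"
  shows "\<exists>T \<le> t. is_convergence_time x p T"
proof -
  let ?H = "{0..t} \<inter> x -` {p}"
  have "closed ?H"
    using cont by (intro continuous_closed_preimage) auto
  then have "compact ({0..t} \<inter> ?H)"
    by (intro compact_Int_closed compact_Icc)
  then have "compact ?H" by (simp add: Int_assoc[symmetric])
  moreover have "?H \<noteq> {}" using hit by auto
  ultimately obtain T where T: "T \<in> ?H" "\<And>s. s \<in> ?H \<Longrightarrow> T \<le> s"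
    using compact_attains_inf[of ?H] by blast
  have "is_convergence_time x p T"
    unfolding is_convergence_time_def using T by force
  then show ?thesis using T by auto
qed

lemma first_zero_exists:
  fixes u :: "real \<Rightarrow> real"
  assumes "continuous_on {0..t} u" "u 0 > 0" "t \<ge> 0" "u t \<le> 0"
  shows "\<exists>z. is_first_positive_zero u z"
proof -
  have "\<exists>s\<ge>0. s \<le> t \<and> u s = 0"
    by (rule IVT2'[of u t 0 0]) (use assms in auto)
  then obtain s where "s \<in> {0..t}" "u s = 0" by auto
  then obtain z where z: "is_convergence_time u 0 z"
    using first_hitting_time_exists[OF assms(1)] by blast
  moreover have "z \<noteq> 0" using z assms(2) by (auto simp: is_convergence_time_def)
  ultimately have "is_first_positive_zero u z"
    by (auto simp: is_convergence_time_def is_first_positive_zero_def)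
  then show ?thesis ..
qed

lemma is_first_positive_zero_nonneg:
  fixes u :: "real \<Rightarrow> real"
  assumes z: "is_first_positive_zero u z" and cont: "continuous_on {0..z} u" and "u 0 > 0"
    and s: "s \<in> {0..z}"
  shows "u s \<ge> 0"
proof (rule ccontr)
  assume "\<not> u s \<ge> 0"
  moreover have "continuous_on {0..s} u" by (rule continuous_on_subset[OF cont]) (use s in auto)
  ultimately have "\<exists>r\<ge>0. r \<le> s \<and> u r = 0"
    by (intro IVT2') (use assms(3) s in auto)
  then obtain r where r: "0 \<le> r" "r \<le> s" "u r = 0" by auto
  then have "r \<noteq> 0" "r \<noteq> s" using \<open>\<not> u s \<ge> 0\<close> assms(3) by auto
  then show False using z r s unfolding is_first_positive_zero_def by force
qed

text \<open>
  Otherwise \<open>u(t) = E(-c t\<^sup>a)\<close> is positive on \<open>[0,\<infinity>)\<close>. In \<open>u(t) = 1 - c \<integral> k(t - s) u(s) ds\<close>, where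
  \<open>k\<close> is the Riemann-Liouville kernel of order \<open>a > 1\<close>, the part of the integral over \<open>[0,1]\<close>
  alone is at least \<open>k(t - 1) m\<close> with \<open>m = min u\<close> on \<open>[0,1]\<close>, and \<open>k\<close> is unbounded.
\<close>
lemma mittag_leffler_first_zero_exists:
  assumes a: "a > 1" and c: "c > 0"
  shows "\<exists>z. is_first_positive_zero (\<lambda>t. mittag_leffler a 1 (- c * t powr a)) z"
proof -
  define u where "u t = 1 - c * ml_kernel c a (a + 1) t" for t
  have u: "mittag_leffler a 1 (- c * t powr a) = u t" if "t \<ge> 0" for t
    unfolding u_def using mittag_leffler_conv_ml_kernel[of a t c] a that by simp
  have cont: "continuous_on S u" for S
    unfolding u_def using a by (auto intro!: continuous_intros)
  have u0: "u 0 = 1" by (simp add: u_def)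
  have "\<exists>t\<ge>0. u t \<le> 0"
  proof (rule ccontr)
    assume "\<not> (\<exists>t\<ge>0. u t \<le> 0)"
    then have pos: "u t > 0" if "t \<ge> 0" for t using that not_le by blast
    obtain s0 where s0: "s0 \<in> {0..1}" "\<And>s. s \<in> {0..1} \<Longrightarrow> u s0 \<le> u s"
      using continuous_attains_inf[of "{0..1}" u] cont by auto
    define m where "m = u s0"
    have m: "m > 0" using pos s0 by (simp add: m_def)
    have Ga: "Gamma a > 0" using a by simp
    \<comment> \<open>The time at which the lower bound \<open>k(t - 1) m\<close> of the integral reaches \<open>1/c\<close>.\<close>
    define t where "t = 1 + (Gamma a / (c * m)) powr (1 / (a - 1))"
    have t: "t > 1" using Ga c m by (simp add: t_def)
    have rt: "rl_kernel a (t - 1) = 1 / (c * m)"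
      using a c m less_imp_neq[OF Ga] by (simp add: rl_kernel_def t_def powr_powr)
    \<comment> \<open>The product of the two kernels of order \<open>1\<close> is the indicator of the open interval from \<open>0\<close> to \<open>1\<close>.\<close>
    have I1: "has_bochner_integral lborel (\<lambda>s. rl_kernel a (t - 1) * m * (rl_kernel 1 (1 - s) * rl_kernel 1 s))
        (rl_kernel a (t - 1) * m * rl_kernel (1 + 1) 1)"
      by (intro has_bochner_integral_mult_right rl_kernel_convolution) auto
    have I2: "has_bochner_integral lborel (\<lambda>s. rl_kernel a (t - s) * ml_kernel c a 1 s) (ml_kernel c a (1 + a) t)"
      using a by (intro ml_kernel_convolution) auto
    have le: "rl_kernel a (t - 1) * m * (rl_kernel 1 (1 - s) * rl_kernel 1 s) \<le> rl_kernel a (t - s) * ml_kernel c a 1 s" for s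
    proof (cases "0 < s")
      case s: True
      have ml: "ml_kernel c a 1 s = u s"
        using ml_kernel_1[of a s c] u[of s] s a by simp
      show ?thesis
      proof (cases "s < 1")
        case True
        have "rl_kernel a (t - 1) \<le> rl_kernel a (t - s)"
          unfolding rl_kernel_def using a True t Ga by (intro divide_right_mono powr_mono2) auto
        moreover have "m \<le> u s" unfolding m_def using s0 s True by simp
        ultimately have "rl_kernel a (t - 1) * m \<le> rl_kernel a (t - s) * u s"
          using m a rl_kernel_nonneg[of a] by (intro mult_mono) auto
        then show ?thesis using s True ml by (simp add: rl_kernel_def)
      next
        case False
        then show ?thesis using ml pos[of s] s a rl_kernel_nonneg[of a "t - s"]
          by (simp add: order_less_imp_le)
      qed
    qed simp
    have "rl_kernel a (t - 1) * m * rl_kernel (1 + 1) 1 \<le> ml_kernel c a (1 + a) t"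
      using has_bochner_integral_integral_eq[OF I1] has_bochner_integral_integral_eq[OF I2]
        integral_mono[OF _ _ le, of lborel "\<lambda>s. s"] I1 I2
      unfolding has_bochner_integral_iff by metis
    moreover have "rl_kernel a (t - 1) * m * rl_kernel (1 + 1) 1 = 1 / c"
      using c m Gamma_fact[of 1, where 'a = real] by (simp add: rt) (simp add: rl_kernel_def)
    ultimately have "c * (1 / c) \<le> c * ml_kernel c a (1 + a) t"
      using c by (intro mult_left_mono) auto
    then have "1 \<le> c * ml_kernel c a (a + 1) t"
      using c by (simp add: add.commute)
    then show False using pos[of t] t by (simp add: u_def)
  qed
  then obtain t where "t \<ge> 0" "u t \<le> 0" by blast
  then have "\<exists>z. is_first_positive_zero u z"
    by (intro first_zero_exists[of t]) (use u0 cont in auto)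
  then show ?thesis
    unfolding is_first_positive_zero_def using u by auto
qed

lemma mittag_leffler_first_zero_scale:
  assumes a: "a > 0" and c: "c > 0" and d: "d > 0"
    and z: "is_first_positive_zero (\<lambda>t. mittag_leffler a 1 (- c * t powr a)) z"
  shows "is_first_positive_zero (\<lambda>t. mittag_leffler a 1 (- d * t powr a)) ((c / d) powr (1 / a) * z)"
proof -
  define k where "k = (c / d) powr (1 / a)"
  have k: "k > 0" using c d by (simp add: k_def)
  have ka: "d * k powr a = c" using a c d by (simp add: k_def powr_powr)
  have eq: "- d * s powr a = - c * (s / k) powr a" if "s > 0" for s
    using that k ka by (simp add: powr_divide field_simps)
  have zpos: "z > 0" using z by (simp add: is_first_positive_zero_def)
  have "mittag_leffler a 1 (- d * (k * z) powr a) = 0"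
    unfolding eq[OF mult_pos_pos[OF k zpos]]
    using z k by (simp add: is_first_positive_zero_def)
  moreover have "mittag_leffler a 1 (- d * s powr a) \<noteq> 0" if "s \<in> {0<..<k * z}" for s
  proof -
    have "s > 0" "s / k \<in> {0<..<z}" using that k by (auto simp: field_simps)
    then show ?thesis using z eq[of s] unfolding is_first_positive_zero_def by auto
  qed
  ultimately show ?thesis
    unfolding k_def[symmetric] is_first_positive_zero_def using k zpos by auto
qed

section \<open>A comparison principle for the Caputo derivative\<close>

text \<open>
  The derivative is a pointwise limit of difference quotients, which are continuous once the function
  is continued by constants outside \<open>[a,b]\<close>.
\<close>
lemma borel_measurable_deriv_Ioo:
  fixes g :: "real \<Rightarrow> real"
  assumes ab: "a \<le> b" and cont: "continuous_on {a..b} g" and diff: "\<And>s. s \<in> {a<..<b} \<Longrightarrow> g differentiable (at s)"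
  shows "(\<lambda>s. indicator {a<..<b} s * deriv g s) \<in> borel_measurable borel"
proof -
  define G where "G s = g (max a (min b s))" for s
  have G: "continuous_on UNIV G"
    unfolding G_def by (rule continuous_on_compose2[OF cont]) (use ab in \<open>auto intro!: continuous_intros\<close>)
  have [measurable]: "G \<in> borel_measurable borel"
    using G by (rule borel_measurable_continuous_onI)
  show ?thesis
  proof (rule borel_measurable_LIMSEQ_real)
    fix s
    show "(\<lambda>n. indicator {a<..<b} s * ((G (s + inverse (real (Suc n))) - G s) / inverse (real (Suc n))))
      \<longlonglongrightarrow> indicator {a<..<b} s * deriv g s"
    proof (cases "s \<in> {a<..<b}")
      case True
      have "(g has_real_derivative deriv g s) (at s)"
        using diff[OF True] by (simp add: DERIV_deriv_iff_real_differentiable)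
      then have "(G has_real_derivative deriv g s) (at s)"
        by (rule has_field_derivative_transform_within_open[where S = "{a<..<b}"])
          (use True in \<open>auto simp: G_def\<close>)
      then have "(\<lambda>h. (G (s + h) - G s) / h) \<midarrow>0\<rightarrow> deriv g s"
        by (simp add: DERIV_def)
      moreover have "filterlim (\<lambda>n. inverse (real (Suc n))) (at 0) sequentially"
        using LIMSEQ_inverse_real_of_nat by (auto simp: filterlim_at)
      ultimately have "(\<lambda>n. (G (s + inverse (real (Suc n))) - G s) / inverse (real (Suc n))) \<longlonglongrightarrow> deriv g s"
        by (rule filterlim_compose)
      then show ?thesis by (rule tendsto_mult_left)
    qed simp
  qed measurable
qed

text \<open>
  The restriction of the derivative to one fixed interval serves all \<open>s\<close> in it, so the Caputo
  derivative becomes a function of \<open>s\<close> to which Fubini's theorem for Borel measure applies.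
\<close>
lemma caputo_eq_convolution:
  assumes \<beta>: "0 < \<beta>" "\<beta> < 1" and s: "0 < s" "s \<le> T"
    and cd: "caputo_differentiable \<beta> \<theta> s"
    and D: "D = (\<lambda>r. indicator {0<..<T} r * deriv \<theta> r)" "D \<in> borel_measurable borel"
  shows "integrable lborel (\<lambda>r. rl_kernel (1 - \<beta>) (s - r) * D r)"
    and "(\<integral>r. rl_kernel (1 - \<beta>) (s - r) * D r \<partial>lborel) = caputo \<beta> \<theta> s"
proof -
  let ?w = "\<lambda>r. deriv \<theta> r / (s - r) powr \<beta>"
  let ?k = "\<lambda>r. rl_kernel (1 - \<beta>) (s - r) * D r"
  note [measurable] = D(2)
  have G: "Gamma (1 - \<beta>) > 0" using \<beta> by simp
  have w: "set_integrable lebesgue {0<..<s} ?w"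
    using cd unfolding caputo_differentiable_def by (auto elim: set_integrable_subset)
  have k: "?k r = (1 / Gamma (1 - \<beta>)) * (indicator {0<..<s} r *\<^sub>R ?w r)" for r
  proof (cases "r \<in> {0<..<s}")
    case True
    then show ?thesis using s by (simp add: D(1) rl_kernel_def powr_minus field_simps)
  next
    case False
    then show ?thesis using s by (auto simp: D(1) indicator_def)
  qed
  have "integrable lebesgue ?k"
    unfolding k using w unfolding set_integrable_def by (intro integrable_mult_right) simp
  then show "integrable lborel ?k"
    by (subst (asm) integrable_completion) auto
  have "(\<integral>r. ?k r \<partial>lborel) = (\<integral>r. ?k r \<partial>lebesgue)"
    by (rule integral_completion[symmetric]) simp
  also have "\<dots> = (1 / Gamma (1 - \<beta>)) * (LINT r:{0<..<s}|lebesgue. ?w r)"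
    unfolding k set_lebesgue_integral_def by (rule integral_mult_right_zero)
  also have "(LINT r:{0<..<s}|lebesgue. ?w r) = integral {0<..<s} ?w"
    by (rule set_lebesgue_integral_eq_integral(2)[OF w])
  also have "\<dots> = integral {0..s} ?w"
    using integral_open_interval_real[of 0 s ?w] by simp
  finally show "(\<integral>r. ?k r \<partial>lborel) = caputo \<beta> \<theta> s"
    unfolding caputo_def by simp
qed

text \<open>
  The weight \<open>(T - r)\<^sup>-\<^sup>\<beta>\<close> in the Caputo integral is at least \<open>T\<^sup>-\<^sup>\<beta>\<close>, so integrability with the
  weight implies integrability without it.
\<close>
lemma caputo_differentiable_integrable_deriv:
  assumes \<beta>: "0 < \<beta>" "\<beta> < 1" and T: "T > 0" and cd: "caputo_differentiable \<beta> \<theta> T"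
  shows "integrable lborel (\<lambda>r. indicator {0<..<T} r * deriv \<theta> r)"
proof -
  define D where "D = (\<lambda>r. indicator {0<..<T} r * deriv \<theta> r)"
  have D [measurable]: "D \<in> borel_measurable borel"
    unfolding D_def using T cd
    by (intro borel_measurable_deriv_Ioo) (auto simp: caputo_differentiable_def)
  have "integrable lborel D"
  proof (rule Bochner_Integration.integrable_bound)
    show "integrable lborel (\<lambda>r. Gamma (1 - \<beta>) * T powr \<beta> * (rl_kernel (1 - \<beta>) (T - r) * D r))"
      using T by (intro integrable_mult_right caputo_eq_convolution(1)[OF \<beta> _ _ cd D_def D]) auto
    show "AE r in lborel. norm (D r) \<le> norm (Gamma (1 - \<beta>) * T powr \<beta> * (rl_kernel (1 - \<beta>) (T - r) * D r))"
    proof (rule AE_I2)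
      fix r
      show "norm (D r) \<le> norm (Gamma (1 - \<beta>) * T powr \<beta> * (rl_kernel (1 - \<beta>) (T - r) * D r))"
      proof (cases "r \<in> {0<..<T}")
        case True
        have G: "Gamma (1 - \<beta>) > 0" using \<beta> by simp
        have "1 = (T - r) powr \<beta> * (T - r) powr - \<beta>"
          using True by (simp add: powr_minus)
        also have "\<dots> \<le> T powr \<beta> * (T - r) powr - \<beta>"
          using True \<beta> by (intro mult_right_mono powr_mono2) auto
        also have "\<dots> = Gamma (1 - \<beta>) * T powr \<beta> * rl_kernel (1 - \<beta>) (T - r)"
          using G True by (simp add: rl_kernel_def)
        finally have "\<bar>D r\<bar> * 1 \<le> \<bar>D r\<bar> * (Gamma (1 - \<beta>) * T powr \<beta> * rl_kernel (1 - \<beta>) (T - r))"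
          by (intro mult_left_mono) auto
        then show ?thesis
          using G \<beta> by (simp add: abs_mult rl_kernel_nonneg mult_ac)
      qed (simp add: D_def)
    qed
  qed measurable
  then show ?thesis by (simp only: D_def)
qed

text \<open>
  Convolution with \<open>k\<close> is adjoint to convolution of the reflected function with \<open>k\<close>; the hypothesis on \<open>e\<close>
  says that \<open>e\<close> is the convolution of \<open>q\<close> and \<open>k\<close>. As \<open>q\<close> and \<open>k\<close> are nonnegative where it matters,
  the inner integral of the absolute value is \<open>\<bar>D r\<bar> * e (T - r)\<close>, which is integrable because
  \<open>e\<close> is bounded on \<open>[0,T]\<close>.
\<close>
lemma convolution_pairing:
  fixes D k q e :: "real \<Rightarrow> real"
  assumes [measurable]: "k \<in> borel_measurable borel" "q \<in> borel_measurable borel"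
    and k: "\<And>t. t \<le> 0 \<Longrightarrow> k t = 0" "\<And>t. 0 \<le> k t"
    and q: "\<And>t. t \<le> T \<Longrightarrow> 0 \<le> q t"
    and conte: "continuous_on UNIV e"
    and inner: "\<And>r. has_bochner_integral lborel (\<lambda>s. q (T - s) * k (s - r)) (e (T - r))"
    and intD: "integrable lborel D" and supp: "\<And>r. r \<notin> {0<..<T} \<Longrightarrow> D r = 0"
  shows "integrable lborel (\<lambda>r. D r * e (T - r))"
    and "integrable lborel (\<lambda>s. q (T - s) * (\<integral>r. k (s - r) * D r \<partial>lborel))"
    and "(\<integral>s. q (T - s) * (\<integral>r. k (s - r) * D r \<partial>lborel) \<partial>lborel) = (\<integral>r. D r * e (T - r) \<partial>lborel)"
proof -
  have [measurable]: "D \<in> borel_measurable borel"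
    using borel_measurable_integrable[OF intD] by simp
  have e_meas [measurable]: "e \<in> borel_measurable borel"
    using conte by (rule borel_measurable_continuous_onI)
  have cont: "continuous_on S (\<lambda>s. e (T - s))" for S
    by (auto intro!: continuous_on_compose2[OF conte] continuous_intros)
  define f where "f = (\<lambda>(r, s). D r * (q (T - s) * k (s - r)))"
  have fm [measurable]: "f \<in> borel_measurable (lborel \<Otimes>\<^sub>M lborel)"
    unfolding f_def by measurable
  have norm_f: "norm (f (r, s)) = \<bar>D r\<bar> * (q (T - s) * k (s - r))" for r s
  proof (cases "0 < r \<and> r < s")
    case True
    then show ?thesis using q[of "T - s"] k(2) by (simp add: f_def abs_mult)
  next
    case False
    then show ?thesis using supp[of r] k(1)[of "s - r"] by (auto simp: f_def)
  qed
  have "bounded ((\<lambda>r. e (T - r)) ` {0..T})"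
    by (intro compact_imp_bounded compact_continuous_image cont compact_Icc)
  then obtain M where "\<forall>y \<in> (\<lambda>r. e (T - r)) ` {0..T}. norm y \<le> M"
    unfolding bounded_iff ..
  then have M: "\<bar>e (T - r)\<bar> \<le> M" if "r \<in> {0..T}" for r
    using that by auto
  have bound: "\<bar>D r * e (T - r)\<bar> \<le> \<bar>M * D r\<bar>" for r
  proof (cases "r \<in> {0<..<T}")
    case True
    then have "\<bar>e (T - r)\<bar> \<le> \<bar>M\<bar>" using M[of r] by force
    then show ?thesis by (simp add: abs_mult mult_right_mono mult.commute[of "\<bar>D r\<bar>"])
  qed (simp add: supp)
  have intDe: "integrable lborel (\<lambda>r. D r * e (T - r))"
    by (rule Bochner_Integration.integrable_bound[of _ "\<lambda>r. M * D r"]) (use bound intD e_meas in auto)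
  have int_f: "integrable (lborel \<Otimes>\<^sub>M lborel) f"
  proof (rule lborel_pair.Fubini_integrable[OF fm])
    have "(\<integral>s. norm (f (r, s)) \<partial>lborel) = \<bar>D r\<bar> * e (T - r)" for r
      unfolding norm_f using inner[of r] by (simp add: has_bochner_integral_iff)
    moreover have "integrable lborel (\<lambda>r. \<bar>D r\<bar> * e (T - r))"
      by (rule Bochner_Integration.integrable_bound[OF intDe]) (auto simp: abs_mult)
    ultimately show "integrable lborel (\<lambda>r. \<integral>s. norm (f (r, s)) \<partial>lborel)" by simp
    show "AE r in lborel. integrable lborel (\<lambda>s. f (r, s))"
      unfolding f_def using inner by (auto simp: has_bochner_integral_iff)
  qed
  then have int_f': "integrable (lborel \<Otimes>\<^sub>M lborel) (case_prod (\<lambda>r s. D r * (q (T - s) * k (s - r))))"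
    by (simp add: f_def)
  have snd: "(\<integral>r. D r * (q (T - s) * k (s - r)) \<partial>lborel) = q (T - s) * (\<integral>r. k (s - r) * D r \<partial>lborel)" for s
    by (simp add: mult_ac flip: integral_mult_right_zero)
  have fst: "(\<integral>s. D r * (q (T - s) * k (s - r)) \<partial>lborel) = D r * e (T - r)" for r
    using inner[of r] by (simp add: has_bochner_integral_iff)
  show "integrable lborel (\<lambda>r. D r * e (T - r))" by (fact intDe)
  show "integrable lborel (\<lambda>s. q (T - s) * (\<integral>r. k (s - r) * D r \<partial>lborel))"
    using lborel_pair.integrable_snd[OF int_f'] unfolding snd .
  show "(\<integral>s. q (T - s) * (\<integral>r. k (s - r) * D r \<partial>lborel) \<partial>lborel) = (\<integral>r. D r * e (T - r) \<partial>lborel)"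
    using lborel_pair.integral_snd[OF int_f'] lborel_pair.integral_fst[OF int_f'] unfolding snd fst by simp
qed

text \<open>
  The kernel is the fractional integral of order \<open>\<beta>\<close> of the Mittag-Leffler function in the hypothesis.
\<close>
lemma ml_kernel_nonneg:
  assumes \<beta>: "\<beta> > 0"
    and nonneg: "\<And>s. s \<in> {0..T} \<Longrightarrow> 0 \<le> mittag_leffler (\<beta> + 1) 1 (- c * s powr (\<beta> + 1))"
    and t: "t \<le> T"
  shows "0 \<le> ml_kernel c (\<beta> + 1) (\<beta> + 1) t"
proof -
  have "ml_kernel c (\<beta> + 1) (\<beta> + 1) t = (\<integral>s. rl_kernel \<beta> (t - s) * ml_kernel c (\<beta> + 1) 1 s \<partial>lborel)"
    using ml_kernel_convolution[of "\<beta> + 1" 1 \<beta> t c] \<beta>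
    by (simp add: add.commute has_bochner_integral_iff)
  also have "\<dots> \<ge> 0"
  proof (rule Bochner_Integration.integral_nonneg)
    fix s
    show "0 \<le> rl_kernel \<beta> (t - s) * ml_kernel c (\<beta> + 1) 1 s"
    proof (cases "0 < s \<and> s < t")
      case True
      then show ?thesis using nonneg[of s] t \<beta>
        by (simp add: ml_kernel_1 rl_kernel_nonneg)
    qed auto
  qed
  finally show ?thesis .
qed

text \<open>
  A supersolution of \<open>D\<^sup>\<beta>\<theta> = cV\<close>, \<open>V' = -\<theta>\<close> lies below the exact solution as long as the latter is
  nonnegative. Beyond that point the weight \<open>q\<close> in the proof may change sign and the argument breaks down.
\<close>
lemma caputo_comparison:
  fixes V \<theta> :: "real \<Rightarrow> real"
  assumes \<beta>: "0 < \<beta>" "\<beta> < 1" and T: "T > 0"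
    and contV: "continuous_on {0..T} V"
    and derV: "\<And>s. s \<in> {0<..<T} \<Longrightarrow> (V has_real_derivative - \<theta> s) (at s)"
    and \<theta>0: "\<theta> 0 = 0"
    and cd: "\<And>s. s \<in> {0<..T} \<Longrightarrow> caputo_differentiable \<beta> \<theta> s"
    and ge: "\<And>s. s \<in> {0<..<T} \<Longrightarrow> c * V s \<le> caputo \<beta> \<theta> s"
    and nonneg: "\<And>s. s \<in> {0..T} \<Longrightarrow> 0 \<le> mittag_leffler (\<beta> + 1) 1 (- c * s powr (\<beta> + 1))"
  shows "V T \<le> V 0 * mittag_leffler (\<beta> + 1) 1 (- c * T powr (\<beta> + 1))"
proof -
  define a where "a = \<beta> + 1"
  have a: "a > 1" "a \<ge> 1" using \<beta> by (simp_all add: a_def)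
  define u q e where "u = (\<lambda>t. 1 - c * ml_kernel c a (a + 1) t)" and "q = ml_kernel c a a" and "e = ml_kernel c a 2"
  have u: "u s = mittag_leffler a 1 (- c * s powr a)" if "s \<ge> 0" for s
    unfolding u_def using mittag_leffler_conv_ml_kernel[OF a(2) that, of c] by simp
  have u': "(u has_real_derivative - c * q s) (at s)" if "s > 0" for s
    unfolding u_def q_def using ml_kernel_has_derivative[OF a(2) a(1) that, of c]
    by (auto intro!: derivative_eq_intros)
  have e': "(e has_real_derivative u s) (at s)" if "s > 0" for s
  proof -
    have der: "((\<lambda>t. t - c * ml_kernel c a (a + 1 + 1) t) has_real_derivative u s) (at s)"
      unfolding u_def using ml_kernel_has_derivative[OF a(2), of "a + 1" s c] a(1) that
      by (auto intro!: derivative_eq_intros)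
    have eq: "t - c * ml_kernel c a (a + 1 + 1) t = e t" if "t > 0" for t
      using that ml_kernel_shift[OF a(2), of 2 c t] Gamma_fact[of 1, where 'a = real]
      by (simp add: e_def rl_kernel_def add_ac)
    show ?thesis
      by (rule has_field_derivative_transform_within_open[OF der, where S = "{0<..}"])
        (use that eq in auto)
  qed
  have cont: "continuous_on S u" "continuous_on S q" "continuous_on S e" for S
    unfolding u_def q_def e_def using a by (auto intro!: continuous_intros continuous_on_ml_kernel)
  have cont': "continuous_on S (\<lambda>s. u (T - s))" "continuous_on S (\<lambda>s. q (T - s))" "continuous_on S (\<lambda>s. e (T - s))" for S
    by (auto intro!: continuous_on_compose2[OF cont(1)[of UNIV]] continuous_on_compose2[OF cont(2)[of UNIV]]
       continuous_on_compose2[OF cont(3)[of UNIV]] continuous_intros)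
  have q_nonneg: "q t \<ge> 0" if "t \<le> T" for t
    unfolding q_def a_def using ml_kernel_nonneg[OF \<beta>(1) nonneg that] .

  have cdT: "continuous_on {0..T} \<theta>" "\<And>s. s \<in> {0<..<T} \<Longrightarrow> \<theta> differentiable (at s)"
    using cd[of T] T by (auto simp: caputo_differentiable_def)
  define D where "D = (\<lambda>r. indicator {0<..<T} r * deriv \<theta> r)"
  have D: "D \<in> borel_measurable borel"
    unfolding D_def using T cdT by (intro borel_measurable_deriv_Ioo) auto
  \<comment> \<open>\<open>H\<close> agrees with the Caputo derivative on the interval and is defined on the whole line.\<close>
  define H where "H s = (\<integral>r. rl_kernel (1 - \<beta>) (s - r) * D r \<partial>lborel)" for s
  have H: "H s = caputo \<beta> \<theta> s" if "s \<in> {0<..T}" for s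
    unfolding H_def using that cd by (intro caputo_eq_convolution(2)[OF \<beta> _ _ _ D_def D]) auto
  have intD: "integrable lborel D"
    unfolding D_def using \<beta> T cd by (intro caputo_differentiable_integrable_deriv) auto

  have inner: "has_bochner_integral lborel (\<lambda>s. q (T - s) * rl_kernel (1 - \<beta>) (s - r)) (e (T - r))" for r
  proof -
    have "has_bochner_integral lborel (\<lambda>s. rl_kernel (1 - \<beta>) (T - r - s) * q s) (e (T - r))"
      using ml_kernel_convolution[OF a(2), of a "1 - \<beta>" "T - r" c] a \<beta>
      by (simp add: q_def e_def) (simp add: a_def)
    then show ?thesis
      by (subst (asm) lborel_has_bochner_integral_real_affine_iff[of "-1" _ _ T]) (simp_all add: mult.commute)
  qed
  have k: "rl_kernel (1 - \<beta>) \<in> borel_measurable borel" "\<And>t. t \<le> 0 \<Longrightarrow> rl_kernel (1 - \<beta>) t = 0"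
    "\<And>t. 0 \<le> rl_kernel (1 - \<beta>) t"
    using \<beta> by (auto simp: rl_kernel_nonneg)
  have supp: "D r = 0" if "r \<notin> {0<..<T}" for r using that by (simp add: D_def)
  have "q \<in> borel_measurable borel" unfolding q_def by measurable
  note pairing = convolution_pairing[OF k(1) this k(2,3) q_nonneg cont(3) inner intD supp]
  have intDe: "integrable lborel (\<lambda>r. D r * e (T - r))"
    by (rule pairing(1))
  have intqH: "integrable lborel (\<lambda>s. q (T - s) * H s)"
    unfolding H_def by (rule pairing(2))
  have swap: "(\<integral>s. q (T - s) * H s \<partial>lborel) = (\<integral>r. D r * e (T - r) \<partial>lborel)"
    unfolding H_def by (rule pairing(3))

  \<comment> \<open>The term \<open>\<theta>(s) e(T - s)\<close> is chosen such that \<open>u(T - s) \<theta>(s)\<close>, of unknown sign, cancels in the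
     derivative and only terms with the weight \<open>q\<close> remain after the exchange \<open>swap\<close>.\<close>
  define \<Psi> where "\<Psi> s = u (T - s) * V s - \<theta> s * e (T - s)" for s
  have "((\<lambda>s. c * (q (T - s) * V s) - deriv \<theta> s * e (T - s)) has_integral (\<Psi> T - \<Psi> 0)) {0..T}"
  proof (rule fundamental_theorem_of_calculus_interior)
    show "continuous_on {0..T} \<Psi>"
      unfolding \<Psi>_def by (intro continuous_intros contV cdT cont')
    fix s assume s: "s \<in> {0<..<T}"
    have t: "(\<theta> has_real_derivative deriv \<theta> s) (at s)"
      using cdT(2)[OF s] by (simp add: DERIV_deriv_iff_real_differentiable)
    have reflect: "((\<lambda>s. T - s) has_real_derivative - 1) (at s)"
      by (auto intro!: derivative_eq_intros)
    have 1: "((\<lambda>s. u (T - s)) has_real_derivative c * q (T - s)) (at s)"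
      using DERIV_chain2[OF u'[of "T - s"] reflect] s by simp
    have 2: "((\<lambda>s. e (T - s)) has_real_derivative - u (T - s)) (at s)"
      using DERIV_chain2[OF e'[of "T - s"] reflect] s by simp
    have "(\<Psi> has_real_derivative (c * (q (T - s) * V s) - deriv \<theta> s * e (T - s))) (at s)"
      unfolding \<Psi>_def by (rule derivative_eq_intros 1 2 t derV[OF s] refl)+ (simp add: algebra_simps)
    then show "(\<Psi> has_vector_derivative (c * (q (T - s) * V s) - deriv \<theta> s * e (T - s))) (at s)"
      by (simp add: has_real_derivative_iff_has_vector_derivative)
  qed (use T in simp)
  moreover have "\<Psi> T - \<Psi> 0 = V T - u T * V 0"
    by (simp add: \<Psi>_def u_def e_def \<theta>0)
  ultimately have ftc: "((\<lambda>s. c * (q (T - s) * V s) - deriv \<theta> s * e (T - s)) has_integral (V T - u T * V 0)) {0<..<T}"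
    by (simp add: has_integral_Icc_iff_Ioo)
  have De: "((\<lambda>s. deriv \<theta> s * e (T - s)) has_integral (\<integral>r. D r * e (T - r) \<partial>lborel)) {0<..<T}"
  proof -
    have "((\<lambda>r. if r \<in> {0<..<T} then deriv \<theta> r * e (T - r) else 0) has_integral (\<integral>r. D r * e (T - r) \<partial>lborel)) UNIV"
      using has_integral_integral_lborel[OF intDe]
      by (rule has_integral_eq[rotated]) (auto simp: D_def)
    then show ?thesis by (simp only: has_integral_restrict_UNIV)
  qed
  have qV: "((\<lambda>s. c * (q (T - s) * V s)) has_integral (V T - u T * V 0 + (\<integral>r. D r * e (T - r) \<partial>lborel))) {0<..<T}"
    using has_integral_add[OF ftc De] by simp
  have qH: "((\<lambda>s. q (T - s) * H s) has_integral (\<integral>r. D r * e (T - r) \<partial>lborel)) {0<..<T}"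
  proof -
    have "((\<lambda>s. if s \<in> {0<..<T} then q (T - s) * H s else 0) has_integral (\<integral>s. q (T - s) * H s \<partial>lborel)) UNIV"
    proof (rule has_integral_eq[OF _ has_integral_integral_lborel[OF intqH]])
      fix s
      have "H s = 0" if "s \<le> 0"
      proof -
        have "(\<lambda>r. rl_kernel (1 - \<beta>) (s - r) * D r) = (\<lambda>r. 0)"
        proof
          fix r show "rl_kernel (1 - \<beta>) (s - r) * D r = 0"
            using that by (cases "r \<in> {0<..<T}") (auto simp: D_def)
        qed
        then show ?thesis by (simp add: H_def)
      qed
      then show "q (T - s) * H s = (if s \<in> {0<..<T} then q (T - s) * H s else 0)"
        by (auto simp: q_def not_less)
    qed
    then show ?thesis unfolding swap by (simp only: has_integral_restrict_UNIV)
  qed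
  have "V T - u T * V 0 + (\<integral>r. D r * e (T - r) \<partial>lborel) \<le> (\<integral>r. D r * e (T - r) \<partial>lborel)"
  proof (rule has_integral_le[OF qV qH])
    fix s assume s: "s \<in> {0<..<T}"
    have "q (T - s) * (c * V s) \<le> q (T - s) * H s"
      using ge[OF s] H[of s] s q_nonneg[of "T - s"] by (intro mult_left_mono) auto
    then show "c * (q (T - s) * V s) \<le> q (T - s) * H s" by (simp add: mult_ac)
  qed
  then show ?thesis using u[of T] T by (simp add: a_def mult.commute)
qed

section \<open>Strongly convex functions and the descent dynamics\<close>

lemma has_derivative_gradient:
  assumes "has_gradient_everywhere f"
  shows "(f has_derivative (\<lambda>h. inner h (gradient f y))) (at y)"
  using assms gradient_eqI[of f y] unfolding has_gradient_everywhere_def gderiv_def by metis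

text \<open>
  Along the segment from \<open>y\<close> to \<open>z\<close> the difference of the two sides has a nonnegative derivative, by
  monotonicity of the gradient.
\<close>
lemma strong_convex_lower_bound:
  assumes sc: "strong_convex \<mu> f"
  shows "f y + inner (gradient f y) (z - y) + \<mu> / 2 * (norm (z - y))\<^sup>2 \<le> f z"
proof -
  define d where "d = z - y"
  define \<phi> where "\<phi> s = f (y + s *\<^sub>R d) - s * inner (gradient f y) d - \<mu> / 2 * s\<^sup>2 * (norm d)\<^sup>2" for s :: real
  have "\<phi> 0 \<le> \<phi> 1"
  proof (rule DERIV_nonneg_imp_nondecreasing[where f = \<phi>])
    fix s :: real assume s: "0 \<le> s" "s \<le> 1"
    let ?D = "inner (gradient f (y + s *\<^sub>R d) - gradient f y) d - \<mu> * s * (norm d)\<^sup>2"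
    have f: "(f has_derivative (\<lambda>h. inner h (gradient f (y + s *\<^sub>R d)))) (at (y + s *\<^sub>R d))"
      using sc by (intro has_derivative_gradient) (simp add: strong_convex_def)
    have "((\<lambda>s. y + s *\<^sub>R d) has_derivative (\<lambda>h. h *\<^sub>R d)) (at s)"
      by (auto intro!: derivative_eq_intros)
    from has_derivative_compose[OF this f]
    have "((\<lambda>s. f (y + s *\<^sub>R d)) has_real_derivative inner (gradient f (y + s *\<^sub>R d)) d) (at s)"
      by (simp add: has_field_derivative_def inner_commute mult_commute_abs)
    then have "(\<phi> has_real_derivative ?D) (at s)"
      unfolding \<phi>_def by (auto intro!: derivative_eq_intros simp: inner_diff_left algebra_simps)
    moreover have "?D \<ge> 0"
    proof (cases "s = 0")
      case False
      have "\<mu> * (norm (s *\<^sub>R d))\<^sup>2 \<le> inner (gradient f (y + s *\<^sub>R d) - gradient f y) (s *\<^sub>R d)"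
        using sc unfolding strong_convex_def by (metis add_diff_cancel_left')
      then have "s * (\<mu> * s * (norm d)\<^sup>2) \<le> s * inner (gradient f (y + s *\<^sub>R d) - gradient f y) d"
        using s by (simp add: power_mult_distrib power2_eq_square mult_ac)
      then show ?thesis using False s by (simp add: mult_le_cancel_left)
    qed simp
    ultimately show "\<exists>D. (\<phi> has_real_derivative D) (at s) \<and> 0 \<le> D" by blast
  qed simp
  then show ?thesis by (simp add: \<phi>_def d_def)
qed

text \<open>
  The lower bound at \<open>z = p\<close> is a quadratic in \<open>p - y\<close>; completing the square gives its minimum
  \<open>- \<parallel>\<nabla>f(y)\<parallel>\<^sup>2 / (2\<mu>)\<close>.
\<close>
lemma polyak_lojasiewicz:
  assumes sc: "strong_convex \<mu> f" and \<mu>: "\<mu> > 0"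
  shows "2 * \<mu> * (f y - f p) \<le> (norm (gradient f y))\<^sup>2"
proof -
  let ?g = "gradient f y"
  have "0 \<le> (norm (?g + \<mu> *\<^sub>R (p - y)))\<^sup>2" by simp
  also have "\<dots> = (norm ?g)\<^sup>2 + 2 * \<mu> * inner ?g (p - y) + \<mu>\<^sup>2 * (norm (p - y))\<^sup>2"
    by (simp only: power2_norm_eq_inner) (simp add: inner_simps inner_commute power2_eq_square algebra_simps)
  also have "\<dots> = (norm ?g)\<^sup>2 + 2 * \<mu> * (inner ?g (p - y) + \<mu> / 2 * (norm (p - y))\<^sup>2)"
    by (simp add: power2_eq_square algebra_simps)
  also have "\<dots> \<le> (norm ?g)\<^sup>2 + 2 * \<mu> * (f p - f y)"
    using strong_convex_lower_bound[OF sc, of y p] \<mu> by (intro add_left_mono mult_left_mono) auto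
  finally show ?thesis by (simp add: algebra_simps)
qed

lemma strong_convex_minimum_strict:
  assumes sc: "strong_convex \<mu> f" and \<mu>: "\<mu> > 0" and min: "\<And>y. f p \<le> f y" and "y \<noteq> p"
  shows "f p < f y"
proof -
  have "(f has_derivative (\<lambda>h. inner h (gradient f p))) (at p)"
    using sc by (intro has_derivative_gradient) (simp add: strong_convex_def)
  then have "(\<lambda>h. inner h (gradient f p)) = (\<lambda>h. 0)"
    using min by (intro differential_zero_maxmin[of p UNIV]) auto
  then have "gradient f p = 0" by (metis inner_eq_zero_iff)
  moreover have "\<mu> / 2 * (norm (y - p))\<^sup>2 > 0" using \<mu> assms(4) by simp
  ultimately show ?thesis using strong_convex_lower_bound[OF sc, of p y] by simp
qed

text \<open>
  The two one-sided bounds on the gradient meet at any pair of distinct points.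
\<close>
lemma strong_convex_modulus_le:
  fixes f :: "'a::euclidean_space \<Rightarrow> real"
  assumes "strong_convex \<mu> f" "L_continuous_gradient L f"
  shows "\<mu> \<le> L"
proof -
  obtain b :: 'a where "b \<in> Basis" using nonempty_Basis by blast
  then have "norm b = 1" by simp
  moreover have "\<mu> * (norm (b - 0))\<^sup>2 \<le> L * (norm (b - 0))\<^sup>2"
    using assms unfolding strong_convex_def L_continuous_gradient_def by (meson order_trans)
  ultimately show ?thesis by simp
qed

text \<open>
  If the minimum were not met on \<open>[0,z]\<close>, the equations would hold up to \<open>z\<close> and the comparison
  principle would give \<open>V(z) \<le> V(0) u(z) = 0\<close>, against strict minimality of \<open>f\<close> at \<open>p\<close>.
\<close>
lemma trajectory_reaches_minimum:
  fixes f :: "'a::real_inner \<Rightarrow> real"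
  assumes min: "\<And>y. f p \<le> f y" and \<mu>: "\<mu> > 0" and sc: "strong_convex \<mu> f" and \<rho>: "\<rho> > 0"
    and \<beta>: "0 < \<beta>" "\<beta> < 1" and tr: "trajectory f p \<rho> \<beta> x \<theta>"
    and z: "is_first_positive_zero (\<lambda>t. mittag_leffler (\<beta> + 1) 1 (- (2 * \<rho> * \<mu>) * t powr (\<beta> + 1))) z"
  shows "\<exists>T\<le>z. is_convergence_time x p T"
proof -
  define c where "c = 2 * \<rho> * \<mu>"
  have z0: "z > 0" using z by (simp add: is_first_positive_zero_def)
  have contx: "continuous_on {0..z} x"
    using tr by (auto simp: trajectory_def elim: continuous_on_subset)
  have "\<exists>s\<in>{0..z}. x s = p"
  proof (rule ccontr)
    assume "\<not> (\<exists>s\<in>{0..z}. x s = p)"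
    then have no_hit: "x s \<noteq> p" if "s \<in> {0..z}" for s using that by auto
    have eqs: "(x has_vector_derivative - (\<theta> t *\<^sub>R (gradient f (x t) /\<^sub>R (norm (gradient f (x t)))\<^sup>2))) (at t)"
      "caputo_differentiable \<beta> \<theta> t" "caputo \<beta> \<theta> t = \<rho> * (norm (gradient f (x t)))\<^sup>2"
      if "t \<in> {0<..z}" for t
      using tr no_hit that unfolding trajectory_def by auto
    have f': "(f has_derivative (\<lambda>h. inner h (gradient f y))) (at y)" for y
      using sc by (intro has_derivative_gradient) (simp add: strong_convex_def)
    define V where "V t = f (x t) - f p" for t
    have pos: "V t > 0" if "t \<in> {0..z}" for t
      unfolding V_def using strong_convex_minimum_strict[OF sc \<mu> min no_hit[OF that]] by simp
    have pl: "2 * \<mu> * V t \<le> (norm (gradient f (x t)))\<^sup>2" for t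
      unfolding V_def using polyak_lojasiewicz[OF sc \<mu>] .
    let ?u = "\<lambda>t. mittag_leffler (\<beta> + 1) 1 (- c * t powr (\<beta> + 1))"
    have u: "?u t = 1 - c * ml_kernel c (\<beta> + 1) (\<beta> + 1 + 1) t" if "t \<ge> 0" for t
      using mittag_leffler_conv_ml_kernel[of "\<beta> + 1" t c] \<beta> that by simp
    have "V z \<le> V 0 * ?u z"
    proof (rule caputo_comparison[OF \<beta> z0, where \<theta> = \<theta>])
      have "continuous_on UNIV f"
        using f' by (auto intro!: continuous_at_imp_continuous_on has_derivative_continuous)
      then show "continuous_on {0..z} V"
        unfolding V_def by (intro continuous_intros continuous_on_compose2[OF _ contx]) auto
    next
      fix t assume t: "t \<in> {0<..<z}"
      let ?g = "gradient f (x t)"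
      have g: "(norm ?g)\<^sup>2 > 0"
        using pl[of t] pos[of t] t \<mu> by (smt (verit) atLeastAtMost_iff greaterThanLessThan_iff mult_pos_pos)
      have "(x has_derivative (\<lambda>h. h *\<^sub>R - (\<theta> t *\<^sub>R (?g /\<^sub>R (norm ?g)\<^sup>2)))) (at t)"
        using eqs(1)[of t] t by (simp add: has_vector_derivative_def)
      from has_derivative_compose[OF this f']
      have "((\<lambda>t. f (x t)) has_derivative (\<lambda>h. h * - \<theta> t)) (at t)"
        using g by (simp add: power2_norm_eq_inner field_simps)
      then show "(V has_real_derivative - \<theta> t) (at t)"
        unfolding V_def by (auto intro!: derivative_eq_intros simp: has_field_derivative_def mult_commute_abs)
      have "\<rho> * (2 * \<mu> * V t) \<le> \<rho> * (norm ?g)\<^sup>2"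
        using pl \<rho> by (intro mult_left_mono) auto
      then show "c * V t \<le> caputo \<beta> \<theta> t"
        using eqs(3)[of t] t by (simp add: c_def mult_ac)
    next
      show "\<theta> 0 = 0" using tr by (simp add: trajectory_def)
    next
      fix t assume "t \<in> {0<..z}" then show "caputo_differentiable \<beta> \<theta> t" by (rule eqs)
    next
      fix t assume t: "t \<in> {0..z}"
      have "continuous_on {0..z} (\<lambda>t. 1 - c * ml_kernel c (\<beta> + 1) (\<beta> + 1 + 1) t)"
        using \<beta> by (auto intro!: continuous_intros)
      then have "continuous_on {0..z} ?u"
        by (rule continuous_on_eq) (use u in auto)
      then show "0 \<le> ?u t"
        using z t u[of 0] by (intro is_first_positive_zero_nonneg[where z = z]) (auto simp: c_def)
    qed
    moreover have "?u z = 0" using z by (simp add: is_first_positive_zero_def c_def)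
    ultimately show False using pos[of z] z0 by simp
  qed
  then show ?thesis using first_hitting_time_exists[OF contx] by auto
qed

theorem theorem5:
  fixes f :: "real ^ 'n \<Rightarrow> real" and xstar :: "real ^ 'n"
    and L \<mu> \<rho> \<beta> :: real
    and x :: "real \<Rightarrow> real ^ 'n" and \<theta> :: "real \<Rightarrow> real"
  assumes "convex_on UNIV f"
    and "\<forall>y. f xstar \<le> f y"
    and "L > 0" and "L_continuous_gradient L f"
    and "\<mu> > 0" and "strong_convex \<mu> f"
    and "\<rho> > 0" and "0 < \<beta>" and "\<beta> < 1"
    and "trajectory f xstar \<rho> \<beta> x \<theta>"
  shows "\<exists>T z. is_convergence_time x xstar T \<and>
           is_first_positive_zero
             (\<lambda>t. mittag_leffler (\<beta> + 1) 1 (- (2 * \<rho> * \<mu>\<^sup>2 / L) * t powr (1 + \<beta>))) z \<and>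
           T \<le> z \<and> (\<mu> < L \<or> x 0 = xstar \<longrightarrow> T < z)"
proof -
  define c where "c = 2 * \<rho> * \<mu>\<^sup>2 / L"
  define d where "d = 2 * \<rho> * \<mu>"
  have c: "c > 0" and d: "d > 0" using assms by (simp_all add: c_def d_def)
  have cd: "c / d = \<mu> / L" using assms by (simp add: c_def d_def power2_eq_square)
  obtain z where z: "is_first_positive_zero (\<lambda>t. mittag_leffler (\<beta> + 1) 1 (- c * t powr (\<beta> + 1))) z"
    using mittag_leffler_first_zero_exists[of "\<beta> + 1" c] c assms by auto
  then have z0: "z > 0" by (simp add: is_first_positive_zero_def)
  define k where "k = (\<mu> / L) powr (1 / (\<beta> + 1))"
  have "is_first_positive_zero (\<lambda>t. mittag_leffler (\<beta> + 1) 1 (- d * t powr (\<beta> + 1))) (k * z)"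
    using mittag_leffler_first_zero_scale[OF _ c d z] assms by (simp add: cd k_def)
  then obtain T where T: "T \<le> k * z" "is_convergence_time x xstar T"
    using trajectory_reaches_minimum[of f xstar \<mu> \<rho> \<beta> x \<theta> "k * z"] assms by (auto simp: d_def)
  have "\<mu> \<le> L" using assms(6,4) by (rule strong_convex_modulus_le)
  then have "k \<le> 1"
    unfolding k_def using assms by (intro powr_le1) auto
  then have "k * z \<le> z" using z0 by simp
  moreover have "T < z" if "\<mu> < L"
  proof -
    have "k < 1 powr (1 / (\<beta> + 1))"
      unfolding k_def using assms that by (intro powr_less_mono2) auto
    then have "k * z < z" using z0 by simp
    then show ?thesis using T by simp
  qed
  moreover have "T < z" if "x 0 = xstar"
  proof -
    have "T = 0" using T(2) that unfolding is_convergence_time_def by force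
    then show ?thesis using z0 by simp
  qed
  ultimately have "T \<le> z" "\<mu> < L \<or> x 0 = xstar \<longrightarrow> T < z"
    using T by auto
  then show ?thesis
    using T z unfolding c_def by (intro exI[of _ T] exI[of _ z]) (simp add: add.commute)
qed

end
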